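(* Let $n\ge2$, let $h$ be the euclidean metric on $\mathbb{R}^{n-1}$, and let ${\not\!\!D}^{res}_{k}(h;\lambda)$ be the residue family operators on spinors of the flat space $(\mathbb{R}^{n-1},h)$. For integers $N\ge1$ and $0\le M\le N-1$, $${\not\!\!D}^{res}_{2N}\big(h;\tfrac{1-n}{2}+M\big)=-e_n\cdot{\not\!\!D}^{res}_{2(N-M-1)+1}\big(h;-\tfrac{1+n}{2}-M\big)\,(D_{\mathcal T}+D_{\mathcal N})^{2M+1},$$ and for integers $N\ge1$ and $0\le M\le N$, $${\not\!\!D}^{res}_{2N+1}\big(h;\tfrac{1-n}{2}+M\big)=e_n\cdot{\not\!\!D}^{res}_{2N-2M}\big(h;-\tfrac{n+1}{2}-M\big)\,(D_{\mathcal T}+D_{\mathcal N})^{2M+1}.$$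
   Context: Clifford and spinor conventions. $e_1,\dots,e_n$ is the standard basis of euclidean $\mathbb{R}^n$, with Clifford relations $e_i\cdot e_j+e_j\cdot e_i=-2\delta_{ij}$; $\Delta_n$ is the complex spinor module. Spinors on $\mathbb{R}^n_{x_n\ge 0}$ are smooth $\Delta_n$-valued functions. The boundary $\mathbb{R}^{n-1}=\{x_n=0\}$ carries the euclidean metric $h$; sections of the spinor bundle of $\mathbb{R}^n$ restricted to $\{x_n=0\}$ are smooth $\Delta_n$-valued functions on $\mathbb{R}^{n-1}$, and $\iota^*$ is the restriction of spinors to $x_n=0$. Put $$D_{\mathcal T}=\sum_{i=1}^{n-1}e_i\cdot\partial_i,\qquad D_{\mathcal N}=e_n\cdot\partial_n,\qquad \widetilde{\not\!\!D}=e_n\cdot\sum_{i=1}^{n-1}e_i\cdot\partial_i .$$ $D_{\mathcal T}$ and $\widetilde{\not\!\!D}$ act both on spinors on $\mathbb{R}^n_{x_n\ge0}$ and on $\Delta_n$-valued functions on $\mathbb{R}^{n-1}$; $D_{\mathcal T}+D_{\mathcal N}$ is the Dirac operator of $\mathbb{R}^n$. Pochhammer symbol: $(a)_l=a(a+1)\cdots(a+l-1)$, $(a)_0=1$. Solution operators of the flat space (the coefficients of formal asymptotic eigenspinors of the hyperbolic Dirac operator), rational in $\lambda$: for $l\in\mathbb{N}_0$, $$\mathcal T_{2l}(h;\lambda)=\frac{1}{2^{2l}\,l!\,(\frac12+\lambda)_l}\widetilde{\not\!\!D}^{2l},\qquad \mathcal T_{2l+1}(h;\lambda)=\frac{1}{2^{2l+1}\,l!\,(\frac12+\lambda)_{l+1}}\widetilde{\not\!\!D}^{2l+1}.$$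 Define, for $N\in\mathbb{N}_0$, $${\not\!\delta}_N(h;\lambda)=\sum_{j=0}^N\frac{1}{(N-j)!}\,\mathcal T_j(h;\lambda)\,\iota^*\partial_n^{N-j}.$$ Residue family operators (the boundary has dimension $n-1$): $${\not\!\!D}^{res}_{2N}(h;\lambda)=2^{2N}N!\Big[\prod_{k=0}^{N-1}(\lambda+\tfrac n2-2N+k)\Big]{\not\!\delta}_{2N}(h;\lambda+\tfrac{n-1}{2}-2N),$$ $${\not\!\!D}^{res}_{2N+1}(h;\lambda)=2^{2N+1}N!\Big[\prod_{k=0}^{N}(\lambda+\tfrac n2-2N-1+k)\Big]{\not\!\delta}_{2N+1}(h;\lambda+\tfrac{n-1}{2}-2N-1).$$ The prefactors cancel all poles, so these are polynomial in $\lambda$ (values at poles of ${\not\!\delta}$ are understood by polynomial continuation). They map spinors on $\mathbb{R}^n_{x_n\ge0}$ to $\Delta_n$-valued functions on $\mathbb{R}^{n-1}$. Empty products are $1$; in particular ${\not\!\!D}^{res}_0(h;\lambda)=\iota^*$. *)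

theory Defs
  imports "HOL-Analysis.Analysis" "HOL-Computational_Algebra.Polynomial"
begin

text \<open>
  Euclidean n-space is \<open>real ^ ('m option)\<close>, so n = CARD('m option) = CARD('m) + 1 \<ge> 2.  The index
  \<open>None\<close> plays the role of n (the normal direction), the indices \<open>Some i\<close> those of 1, ..., n-1;
  the boundary is \<open>real ^ 'm\<close>.  A spinor module is given in coordinates as \<open>complex ^ 's\<close>,
  with \<open>e k\<close> the matrix of Clifford multiplication by the k-th standard basis vector.
\<close>

text \<open>For odd n there are two inequivalent irreducible modules; either may be taken.\<close>

definition spinor_module :: "('k::finite \<Rightarrow> complex ^ 's ^ 's) \<Rightarrow> bool" where
  "spinor_module e \<longleftrightarrow>
     (\<forall>i j. e i ** e j + e j ** e i = (if i = j then mat (- 2) else 0)) \<and>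
     (\<forall>W. vec.subspace W \<and> (\<forall>k. \<forall>v\<in>W. e k *v v \<in> W) \<longrightarrow> W = {0} \<or> W = UNIV)"

definition upper_half_space :: "(real ^ ('m::finite option)) set" where
  "upper_half_space = {x. x $ None \<ge> 0}"

definition boundary_incl :: "real ^ 'm \<Rightarrow> real ^ ('m::finite option)" where
  "boundary_incl y = (\<chi> k. case k of None \<Rightarrow> 0 | Some i \<Rightarrow> y $ i)"

definition boundary_restr :: "(real ^ ('m::finite option) \<Rightarrow> 'a) \<Rightarrow> real ^ 'm \<Rightarrow> 'a" where
  "boundary_restr \<psi> = (\<lambda>y. \<psi> (boundary_incl y))"

text \<open>
  Functions on the half-space are total functions of which only the values on the half-space
  matter: derivatives are taken within the set S, hence are one-sided in the normal direction
  at boundary points.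
\<close>

definition partial_on ::
    "(real ^ 'k) set \<Rightarrow> 'k::finite \<Rightarrow> (real ^ 'k \<Rightarrow> 'a::real_normed_vector) \<Rightarrow> real ^ 'k \<Rightarrow> 'a" where
  "partial_on S k f = (\<lambda>x. frechet_derivative f (at x within S) (axis k 1))"

primrec C_times_on ::
    "nat \<Rightarrow> (real ^ 'k::finite) set \<Rightarrow> (real ^ 'k \<Rightarrow> 'a::real_normed_vector) \<Rightarrow> bool" where
  "C_times_on 0 S f \<longleftrightarrow> continuous_on S f"
| "C_times_on (Suc r) S f \<longleftrightarrow> f differentiable_on S \<and> (\<forall>k. C_times_on r S (partial_on S k f))"

definition smooth_on_set ::
    "(real ^ 'k::finite) set \<Rightarrow> (real ^ 'k \<Rightarrow> 'a::real_normed_vector) \<Rightarrow> bool" where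
  "smooth_on_set S f \<longleftrightarrow> (\<forall>r. C_times_on r S f)"

definition normal_deriv ::
    "(real ^ ('m::finite option) \<Rightarrow> complex ^ 's) \<Rightarrow> real ^ ('m option) \<Rightarrow> complex ^ 's" where
  "normal_deriv = partial_on upper_half_space None"

definition D_tangential ::
    "('m::finite option \<Rightarrow> complex ^ 's ^ 's) \<Rightarrow>
     (real ^ ('m option) \<Rightarrow> complex ^ 's) \<Rightarrow> real ^ ('m option) \<Rightarrow> complex ^ 's" where
  "D_tangential e \<psi> = (\<lambda>x. \<Sum>i\<in>UNIV. e (Some i) *v partial_on upper_half_space (Some i) \<psi> x)"

definition D_normal ::
    "('m::finite option \<Rightarrow> complex ^ 's ^ 's) \<Rightarrow>
     (real ^ ('m option) \<Rightarrow> complex ^ 's) \<Rightarrow> real ^ ('m option) \<Rightarrow> complex ^ 's" where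
  "D_normal e \<psi> = (\<lambda>x. e None *v normal_deriv \<psi> x)"

definition dirac ::
    "('m::finite option \<Rightarrow> complex ^ 's ^ 's) \<Rightarrow>
     (real ^ ('m option) \<Rightarrow> complex ^ 's) \<Rightarrow> real ^ ('m option) \<Rightarrow> complex ^ 's" where
  "dirac e \<psi> = (\<lambda>x. D_tangential e \<psi> x + D_normal e \<psi> x)"

definition D_boundary ::
    "('m::finite option \<Rightarrow> complex ^ 's ^ 's) \<Rightarrow>
     (real ^ 'm \<Rightarrow> complex ^ 's) \<Rightarrow> real ^ 'm \<Rightarrow> complex ^ 's" where
  "D_boundary e \<phi> = (\<lambda>y. e None *v (\<Sum>i\<in>UNIV. e (Some i) *v partial_on UNIV i \<phi> y))"

definition solution_coeff :: "nat \<Rightarrow> complex \<Rightarrow> complex" where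
  "solution_coeff j lam =
     (let l = j div 2 in
      if even j then 1 / (2 ^ (2 * l) * fact l * pochhammer (1/2 + lam) l)
      else 1 / (2 ^ (2 * l + 1) * fact l * pochhammer (1/2 + lam) (l + 1)))"

definition solution_op ::
    "('m::finite option \<Rightarrow> complex ^ 's ^ 's) \<Rightarrow> nat \<Rightarrow> complex \<Rightarrow>
     (real ^ 'm \<Rightarrow> complex ^ 's) \<Rightarrow> real ^ 'm \<Rightarrow> complex ^ 's" where
  "solution_op e j lam \<phi> = (\<lambda>y. solution_coeff j lam *s (D_boundary e ^^ j) \<phi> y)"

definition delta_family ::
    "('m::finite option \<Rightarrow> complex ^ 's ^ 's) \<Rightarrow> nat \<Rightarrow> complex \<Rightarrow>
     (real ^ ('m option) \<Rightarrow> complex ^ 's) \<Rightarrow> real ^ 'm \<Rightarrow> complex ^ 's" where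
  "delta_family e N lam \<psi> = (\<lambda>y. \<Sum>j\<le>N. (1 / fact (N - j)) *s
     solution_op e j lam (boundary_restr ((normal_deriv ^^ (N - j)) \<psi>)) y)"

definition residue_prefactor :: "nat \<Rightarrow> nat \<Rightarrow> complex \<Rightarrow> complex" where
  "residue_prefactor n K lam =
     (let N = K div 2 in
      if even K
      then 2 ^ (2 * N) * fact N * (\<Prod>k<N. lam + of_nat n / 2 - 2 * of_nat N + of_nat k)
      else 2 ^ (2 * N + 1) * fact N * (\<Prod>k\<le>N. lam + of_nat n / 2 - 2 * of_nat N - 1 + of_nat k))"

text \<open>
  The defining formula of the residue families as a rational function of \<open>lam\<close>; at the finitely
  many poles of \<open>delta_family\<close> its value is meaningless, because of \<open>x / 0 = 0\<close>.
\<close>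

definition residue_family_rational ::
    "('m::finite option \<Rightarrow> complex ^ 's ^ 's) \<Rightarrow> nat \<Rightarrow> complex \<Rightarrow>
     (real ^ ('m option) \<Rightarrow> complex ^ 's) \<Rightarrow> real ^ 'm \<Rightarrow> complex ^ 's" where
  "residue_family_rational e K lam \<psi> =
     (let n = CARD('m option) in
      (\<lambda>y. residue_prefactor n K lam *s
           delta_family e K (lam + (of_nat n - 1) / 2 - of_nat K) \<psi> y))"

definition poly_continuation :: "(complex \<Rightarrow> complex) \<Rightarrow> complex \<Rightarrow> complex" where
  "poly_continuation F lam = poly (THE p. finite {\<mu>. poly p \<mu> \<noteq> F \<mu>}) lam"

definition residue_family ::
    "('m::finite option \<Rightarrow> complex ^ 's ^ 's) \<Rightarrow> nat \<Rightarrow> complex \<Rightarrow>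
     (real ^ ('m option) \<Rightarrow> complex ^ 's) \<Rightarrow> real ^ 'm \<Rightarrow> complex ^ 's" where
  "residue_family e K lam \<psi> =
     (\<lambda>y. \<chi> a. poly_continuation (\<lambda>\<mu>. residue_family_rational e K \<mu> \<psi> y $ a) lam)"

lemma poly_continuation_eq:
  assumes "finite {\<mu>. poly p \<mu> \<noteq> F \<mu>}"
  shows "poly_continuation F lam = poly p lam"
proof -
  have "(THE p. finite {\<mu>. poly p \<mu> \<noteq> F \<mu>}) = p"
  proof (rule the_equality)
    show "finite {\<mu>. poly p \<mu> \<noteq> F \<mu>}" by fact
    fix q assume q: "finite {\<mu>. poly q \<mu> \<noteq> F \<mu>}"
    have "{\<mu>. poly (q - p) \<mu> \<noteq> 0} \<subseteq> {\<mu>. poly p \<mu> \<noteq> F \<mu>} \<union> {\<mu>. poly q \<mu> \<noteq> F \<mu>}" by auto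
    then have fin: "finite {\<mu>. poly (q - p) \<mu> \<noteq> 0}"
      using assms q by (meson finite_UnI finite_subset)
    show "q = p"
    proof (rule ccontr)
      assume "q \<noteq> p"
      then have "finite {\<mu>. poly (q - p) \<mu> = 0}" by (intro poly_roots_finite) simp
      with fin have "finite ({\<mu>. poly (q - p) \<mu> = 0} \<union> {\<mu>. poly (q - p) \<mu> \<noteq> 0})" by blast
      moreover have "{\<mu>. poly (q - p) \<mu> = 0} \<union> {\<mu>. poly (q - p) \<mu> \<noteq> 0} = UNIV" by auto
      ultimately show False using infinite_UNIV_char_0[where 'a = complex] by metis
    qed
  qed
  then show ?thesis by (simp add: poly_continuation_def)
qed

lemma residue_prefactor_pochhammer:
  "residue_prefactor n K lam =
     2 ^ K * fact (K div 2) * pochhammer (lam + (of_nat n / 2 - of_nat K)) ((K + 1) div 2)"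
proof (cases "even K")
  case True
  then obtain N where N: "K = 2 * N" by blast
  show ?thesis
    by (simp add: N residue_prefactor_def pochhammer_prod atLeast0LessThan
        algebra_simps)
next
  case False
  then obtain N where N: "K = 2 * N + 1" by (blast elim: oddE)
  have "pochhammer a (Suc N) = (\<Prod>k\<le>N. a + of_nat k)" for a :: complex
    by (simp add: pochhammer_prod atLeast0LessThan lessThan_Suc_atMost)
  then show ?thesis
    by (simp add: N residue_prefactor_def algebra_simps)
qed

lemma solution_coeff_pochhammer:
  "solution_coeff j lam = 1 / (2 ^ j * fact (j div 2) * pochhammer (1/2 + lam) ((j + 1) div 2))"
proof (cases "even j")
  case True
  then obtain l where "j = 2 * l" by blast
  then show ?thesis by (simp add: solution_coeff_def)
next
  case False
  then obtain l where "j = 2 * l + 1" by (blast elim: oddE)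
  then show ?thesis by (simp add: solution_coeff_def)
qed

lemma poly_pochhammer:
  "poly (pochhammer p m) x = pochhammer (poly p x) m" for x :: complex
  by (induction m) (simp_all add: pochhammer_Suc)

text \<open>The prefactor cancels all poles, so the polynomial in \<open>poly_continuation\<close> exists.\<close>

lemma residue_family_rational_polynomial:
  fixes e :: "'m::finite option \<Rightarrow> complex ^ 's ^ 's"
  shows "\<exists>p. finite {\<mu>. poly p \<mu> \<noteq> residue_family_rational e K \<mu> \<psi> y $ a}"
proof -
  define n where "n = CARD('m option)"
  define s :: complex where "s = (of_nat n / 2 - of_nat K)"
  define c where "c j = 1 / fact (K - j) * (2 ^ K * fact (K div 2) / (2 ^ j * fact (j div 2))) *
    (D_boundary e ^^ j) (boundary_restr ((normal_deriv ^^ (K - j)) \<psi>)) y $ a" for j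
  define p where "p = (\<Sum>j\<le>K. smult (c j)
    (pochhammer [:s + of_nat ((j + 1) div 2), 1:] ((K + 1) div 2 - (j + 1) div 2)))"
  have raw: "residue_family_rational e K \<mu> \<psi> y $ a =
      (\<Sum>j\<le>K. c j * (pochhammer (\<mu> + s) ((K + 1) div 2) / pochhammer (\<mu> + s) ((j + 1) div 2)))" for \<mu>
  proof -
    have shift: "1/2 + (\<mu> + (of_nat n - 1) / 2 - of_nat K) = \<mu> + s"
      by (simp add: s_def field_simps)
    show ?thesis
      unfolding residue_family_rational_def Let_def n_def[symmetric] delta_family_def
        solution_op_def solution_coeff_pochhammer shift residue_prefactor_pochhammer
        s_def[symmetric]
      by (simp add: sum_distrib_left c_def mult_ac)
  qed
  have eq: "poly p \<mu> = residue_family_rational e K \<mu> \<psi> y $ a"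
    if "pochhammer (\<mu> + s) ((K + 1) div 2) \<noteq> 0" for \<mu>
    unfolding raw p_def poly_sum poly_smult poly_pochhammer
  proof (rule sum.cong[OF refl])
    fix j assume "j \<in> {..K}"
    then have le: "(j + 1) div 2 \<le> (K + 1) div 2" by (simp add: div_le_mono)
    have "pochhammer (\<mu> + s) ((K + 1) div 2) = pochhammer (\<mu> + s) ((j + 1) div 2) *
        pochhammer (\<mu> + s + of_nat ((j + 1) div 2)) ((K + 1) div 2 - (j + 1) div 2)"
      by (rule pochhammer_product[OF le])
    with that show "c j * pochhammer (poly [:s + of_nat ((j + 1) div 2), 1:] \<mu>)
          ((K + 1) div 2 - (j + 1) div 2) =
        c j * (pochhammer (\<mu> + s) ((K + 1) div 2) / pochhammer (\<mu> + s) ((j + 1) div 2))"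
      by (simp add: add_ac)
  qed
  have "{\<mu>. poly p \<mu> \<noteq> residue_family_rational e K \<mu> \<psi> y $ a}
      \<subseteq> {\<mu>. pochhammer (\<mu> + s) ((K + 1) div 2) = 0}" using eq by blast
  also have "\<dots> \<subseteq> (\<lambda>k. - of_nat k - s) ` {..<(K + 1) div 2}"
  proof
    fix \<mu> assume "\<mu> \<in> {\<mu>. pochhammer (\<mu> + s) ((K + 1) div 2) = 0}"
    then obtain k where "k < (K + 1) div 2" "\<mu> + s = - of_nat k"
      by (auto simp: pochhammer_eq_0_iff)
    then show "\<mu> \<in> (\<lambda>k. - of_nat k - s) ` {..<(K + 1) div 2}"
      by (auto intro!: image_eqI[of _ _ k] simp: algebra_simps eq_neg_iff_add_eq_0)
  qed
  finally have "finite {\<mu>. poly p \<mu> \<noteq> residue_family_rational e K \<mu> \<psi> y $ a}"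
    by (rule finite_subset) simp
  then show ?thesis by blast
qed

end

theory Submission
  imports Defs
begin

text \<open>
  Write \<open>X\<close> for the boundary operator \<open>D_boundary e\<close> and \<open>Y\<close> for the normal derivative.  The
  residue family of order \<open>K\<close> is a homogeneous polynomial \<open>P\<^sub>K(X, Y; a)\<close> followed by restriction to the
  boundary, with \<open>a = lam + n/2 - K\<close>; both sides of the theorem have the same \<open>a = 1/2 + M - K\<close>.
  On smooth spinors the Dirac operator is \<open>e\<^sub>n (Y - X)\<close>, and \<open>e\<^sub>n\<close> anticommutes with \<open>X\<close>, so that composing with
  \<open>D\<^sup>2\<close> multiplies the polynomial by \<open>X\<^sup>2 - Y\<^sup>2\<close>.  The theorem becomes
  \<open>P\<^sub>K(X, Y) = (-1)\<^sup>K P\<^sub>L(-X, Y) (Y - X) (X\<^sup>2 - Y\<^sup>2)\<^sup>M\<close> with \<open>K = L + 2M + 1\<close>.  The two-term recursion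
  of the coefficients says that \<open>P\<^sub>K(x, 1)\<close> is the only monic polynomial of degree \<open>K\<close> with
  \<open>T f = K f - x f'\<close>, where \<open>T\<close> is the Dunkl operator with parameter \<open>a - 1/2 = M - K\<close>, and the right-hand
  side solves this equation too.
\<close>

section \<open>One-sided partial derivatives\<close>

text \<open>
  Covers both the half-space and the boundary.  Room in every positive coordinate direction makes
  one-sided derivatives unique and allows the second-difference argument for mixed partials.
\<close>

definition orthant_closed :: "(real ^ 'k::finite) set \<Rightarrow> bool" where
  "orthant_closed S \<longleftrightarrow> (\<forall>x\<in>S. \<forall>k. \<forall>s\<ge>0. x + s *\<^sub>R axis k 1 \<in> S)"

lemma orthant_closedD: "orthant_closed S \<Longrightarrow> x \<in> S \<Longrightarrow> s \<ge> 0 \<Longrightarrow> x + s *\<^sub>R axis k 1 \<in> S"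
  by (simp add: orthant_closed_def)

lemma orthant_closed_UNIV [simp]: "orthant_closed UNIV"
  by (simp add: orthant_closed_def)

lemma orthant_closed_upper_half_space [simp]: "orthant_closed upper_half_space"
  by (simp add: orthant_closed_def upper_half_space_def axis_def)

text \<open>Every axis direction contains points \<open>x + d * axis k 1\<close> of \<open>S\<close>
  with arbitrarily small \<open>d > 0\<close>, and this is enough for the derivative within
  \<open>S\<close> to be unique, also at boundary points.\<close>

lemma partial_on_eqI:
  fixes f :: "real ^ 'k::finite \<Rightarrow> 'a::real_normed_vector"
  assumes S: "orthant_closed S" "x \<in> S" and f: "(f has_derivative f') (at x within S)"
  shows "partial_on S k f x = f' (axis k 1)"
proof -
  have "frechet_derivative f (at x within S) = f'"
  proof (rule frechet_derivative_unique_within)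
    show "(f has_derivative frechet_derivative f (at x within S)) (at x within S)"
      using f frechet_derivative_works differentiableI by blast
    show "(f has_derivative f') (at x within S)" by fact
    fix i :: "real ^ 'k" and \<epsilon> :: real assume "i \<in> Basis" "\<epsilon> > 0"
    then obtain k where "i = axis k 1" by (auto simp: Basis_vec_def)
    then show "\<exists>d. 0 < \<bar>d\<bar> \<and> \<bar>d\<bar> < \<epsilon> \<and> x + d *\<^sub>R i \<in> S"
      using S \<open>\<epsilon> > 0\<close> by (intro exI[of _ "\<epsilon> / 2"]) (auto intro: orthant_closedD)
  qed
  then show ?thesis by (simp add: partial_on_def)
qed

lemma has_derivative_cong_on:
  assumes "\<And>x. x \<in> S \<Longrightarrow> f x = g x" "x \<in> S"
  shows "(f has_derivative f') (at x within S) \<longleftrightarrow> (g has_derivative f') (at x within S)"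
  using assms by (metis has_derivative_transform)

text \<open>No differentiability is assumed: \<open>f\<close> and \<open>g\<close> have the same
  derivatives within \<open>S\<close> at \<open>x\<close>, so the choice operator in
  \<open>frechet_derivative\<close> returns the same value for both.\<close>

lemma partial_on_cong:
  assumes "\<And>x. x \<in> S \<Longrightarrow> f x = g x" "x \<in> S"
  shows "partial_on S k f x = partial_on S k g x"
  using has_derivative_cong_on[OF assms] by (simp add: partial_on_def frechet_derivative_def)

lemma C_times_on_cong:
  assumes "\<And>x. x \<in> S \<Longrightarrow> f x = g x"
  shows "C_times_on r S f \<longleftrightarrow> C_times_on r S g"
  using assms
proof (induction r arbitrary: f g)
  case 0
  then show ?case using continuous_on_cong[of S S f g] by simp
next
  case (Suc r)
  have "f differentiable_on S \<longleftrightarrow> g differentiable_on S"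
    unfolding differentiable_on_def differentiable_def
    using has_derivative_cong_on[of S f g] Suc.prems by blast
  moreover have "C_times_on r S (partial_on S k f) \<longleftrightarrow> C_times_on r S (partial_on S k g)" for k
    by (rule Suc.IH) (rule partial_on_cong[OF Suc.prems])
  ultimately show ?case by simp
qed

lemma smooth_on_set_partial_on: "smooth_on_set S f \<Longrightarrow> smooth_on_set S (partial_on S k f)"
  unfolding smooth_on_set_def by (metis C_times_on.simps(2))

lemma smooth_on_set_differentiable:
  "smooth_on_set S f \<Longrightarrow> f differentiable_on S"
  unfolding smooth_on_set_def by (metis C_times_on.simps(2))

lemma smooth_on_set_C_times_on: "smooth_on_set S f \<Longrightarrow> C_times_on r S f"
  by (simp add: smooth_on_set_def)

lemma has_derivative_frechet_on:
  "f differentiable_on S \<Longrightarrow> x \<in> S \<Longrightarrow>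
    (f has_derivative frechet_derivative f (at x within S)) (at x within S)"
  by (simp add: differentiable_on_def frechet_derivative_works)

lemma partial_on_linear:
  assumes "orthant_closed S" "f differentiable_on S" "x \<in> S" "bounded_linear L"
  shows "partial_on S k (\<lambda>x. L (f x)) x = L (partial_on S k f x)"
  using partial_on_eqI[OF assms(1,3)
      bounded_linear.has_derivative[OF assms(4) has_derivative_frechet_on[OF assms(2,3)]]]
  by (simp add: partial_on_def)

lemma partial_on_diff:
  assumes "orthant_closed S" "f differentiable_on S" "g differentiable_on S" "x \<in> S"
  shows "partial_on S k (\<lambda>x. f x - g x) x = partial_on S k f x - partial_on S k g x"
  using partial_on_eqI[OF assms(1,4)
      has_derivative_diff[OF has_derivative_frechet_on[OF assms(2,4)]
        has_derivative_frechet_on[OF assms(3,4)]]]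
  by (simp add: partial_on_def)

lemma partial_on_sum:
  assumes "orthant_closed S" "\<And>i. i \<in> I \<Longrightarrow> f i differentiable_on S" "x \<in> S"
  shows "partial_on S k (\<lambda>x. \<Sum>i\<in>I. f i x) x = (\<Sum>i\<in>I. partial_on S k (f i) x)"
  using partial_on_eqI[OF assms(1,3)
      has_derivative_sum[OF has_derivative_frechet_on[OF assms(2,3)]], of I]
  by (simp add: partial_on_def)

lemma C_times_on_linear:
  assumes S: "orthant_closed S" and L: "bounded_linear L"
  shows "C_times_on r S f \<Longrightarrow> C_times_on r S (\<lambda>x. L (f x))"
proof (induction r arbitrary: f)
  case 0
  then show ?case using bounded_linear.continuous_on[OF L] by simp
next
  case (Suc r)
  have f: "f differentiable_on S" using Suc.prems by simp
  have "C_times_on r S (partial_on S k (\<lambda>x. L (f x)))" for k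
    using Suc.IH[of "partial_on S k f"] Suc.prems partial_on_linear[OF S f _ L]
    by (subst C_times_on_cong[of S _ "\<lambda>x. L (partial_on S k f x)"]) auto
  moreover have "(\<lambda>x. L (f x)) differentiable_on S"
    using f unfolding differentiable_on_def differentiable_def
    by (metis L bounded_linear.has_derivative)
  ultimately show ?case by simp
qed

lemma C_times_on_sum:
  assumes S: "orthant_closed S"
  shows "(\<And>i. i \<in> I \<Longrightarrow> C_times_on r S (f i)) \<Longrightarrow> C_times_on r S (\<lambda>x. \<Sum>i\<in>I. f i x)"
proof (induction r arbitrary: f)
  case 0
  then show ?case by (auto intro: continuous_on_sum)
next
  case (Suc r)
  have f: "\<And>i. i \<in> I \<Longrightarrow> f i differentiable_on S" using Suc.prems by simp
  have "C_times_on r S (partial_on S k (\<lambda>x. \<Sum>i\<in>I. f i x))" for k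
    using Suc.IH[of "\<lambda>i. partial_on S k (f i)"] Suc.prems partial_on_sum[OF S f]
    by (subst C_times_on_cong[of S _ "\<lambda>x. \<Sum>i\<in>I. partial_on S k (f i) x"]) auto
  moreover have "(\<lambda>x. \<Sum>i\<in>I. f i x) differentiable_on S"
    unfolding differentiable_on_def
    by (auto intro!: differentiableI has_derivative_sum has_derivative_frechet_on f)
  ultimately show ?case by simp
qed

lemma smooth_on_set_linear:
  "orthant_closed S \<Longrightarrow> bounded_linear L \<Longrightarrow> smooth_on_set S f \<Longrightarrow> smooth_on_set S (\<lambda>x. L (f x))"
  by (simp add: smooth_on_set_def C_times_on_linear)

lemma smooth_on_set_sum:
  "orthant_closed S \<Longrightarrow> (\<And>i. i \<in> I \<Longrightarrow> smooth_on_set S (f i)) \<Longrightarrow>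
    smooth_on_set S (\<lambda>x. \<Sum>i\<in>I. f i x)"
  by (simp add: smooth_on_set_def C_times_on_sum)

lemma smooth_on_set_diff:
  assumes "orthant_closed S" "smooth_on_set S f" "smooth_on_set S g"
  shows "smooth_on_set S (\<lambda>x. f x - g x)"
proof -
  have "smooth_on_set S (\<lambda>x. - g x)"
    using smooth_on_set_linear[OF assms(1) bounded_linear_minus[OF bounded_linear_ident] assms(3)] .
  \<comment> \<open>The difference is treated as a sum indexed by \<open>bool\<close>, so that
    closure under sums applies.\<close>
  then have "smooth_on_set S (\<lambda>x. if b then f x else - g x)" for b
    using assms(2) by (cases b) simp_all
  from smooth_on_set_sum[OF assms(1), of UNIV "\<lambda>b x. if b then f x else - g x", OF this]
  show ?thesis by (simp add: UNIV_bool)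
qed

section \<open>Symmetry of one-sided mixed partial derivatives\<close>

lemma has_real_derivative_along_axis:
  fixes f :: "real ^ 'k::finite \<Rightarrow> real"
  assumes S: "orthant_closed S" and f: "f differentiable_on S" and b: "b \<in> S" and t: "t \<ge> 0"
  shows "((\<lambda>t. f (b + t *\<^sub>R axis k 1)) has_real_derivative
           partial_on S k f (b + t *\<^sub>R axis k 1)) (at t within {0..})"
proof -
  let ?p = "\<lambda>t. b + t *\<^sub>R axis k 1" and ?f' = "frechet_derivative f (at (b + t *\<^sub>R axis k 1) within S)"
  have pS: "?p t \<in> S" if "t \<ge> 0" for t using S b that by (rule orthant_closedD)
  have f': "(f has_derivative ?f') (at (?p t) within S)"
    using f pS[OF t] by (rule has_derivative_frechet_on)
  have p: "(?p has_derivative (\<lambda>h. h *\<^sub>R axis k 1)) (at t within {0..})"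
    by (auto intro!: derivative_eq_intros)
  have "((\<lambda>t. f (?p t)) has_derivative (\<lambda>h. ?f' (h *\<^sub>R axis k 1))) (at t within {0..})"
    by (rule has_derivative_in_compose[OF p]) (rule has_derivative_subset[OF f'], use pS in auto)
  moreover have "?f' (h *\<^sub>R axis k 1) = partial_on S k f (?p t) * h" for h
    using linear_scale[OF has_derivative_linear[OF f']] by (simp add: partial_on_def)
  ultimately show ?thesis by (simp add: has_field_derivative_def)
qed

lemma mean_value_half_line:
  assumes d: "\<And>t. t \<ge> 0 \<Longrightarrow> (g has_real_derivative g' t) (at t within {0..})"
    and h: "h > (0::real)"
  shows "\<exists>\<xi>. 0 < \<xi> \<and> \<xi> < h \<and> g h - g 0 = h * g' \<xi>"
proof -
  have "(g has_derivative (*) (g' t)) (at t within {0..h})" if "0 \<le> t" for t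
    using DERIV_subset[OF d[OF that], of "{0..h}"] by (simp add: has_field_derivative_def)
  then obtain \<xi> where "\<xi> \<in> {0<..<h}" "g h - g 0 = g' \<xi> * (h - 0)"
    using mvt_simple[OF h, of g "\<lambda>t. (*) (g' t)"] by auto
  then show ?thesis by (auto simp: mult.commute)
qed

text \<open>The mean value theorem is used twice: first in direction \<open>i\<close> for the
  difference of \<open>f\<close> along two parallel segments, then in direction \<open>j\<close> for
  \<open>partial_on S i f\<close>. All points arise from \<open>a\<close> by nonnegative steps, so
  they stay in \<open>S\<close>.\<close>

lemma second_difference_mean_value:
  fixes f :: "real ^ 'k::finite \<Rightarrow> real"
  assumes S: "orthant_closed S" and f: "f differentiable_on S"
    and f': "partial_on S i f differentiable_on S" and a: "a \<in> S" and h: "h > 0"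
  shows "\<exists>\<xi> \<eta>. 0 < \<xi> \<and> \<xi> < h \<and> 0 < \<eta> \<and> \<eta> < h \<and>
    f (a + h *\<^sub>R axis j 1 + h *\<^sub>R axis i 1) - f (a + h *\<^sub>R axis i 1)
      - f (a + h *\<^sub>R axis j 1) + f a
    = h * (h * partial_on S j (partial_on S i f) (a + \<xi> *\<^sub>R axis i 1 + \<eta> *\<^sub>R axis j 1))"
proof -
  have aj: "a + h *\<^sub>R axis j 1 \<in> S" using S a h by (auto intro: orthant_closedD)
  obtain \<xi> where \<xi>: "0 < \<xi>" "\<xi> < h"
    "(f (a + h *\<^sub>R axis j 1 + h *\<^sub>R axis i 1) - f (a + h *\<^sub>R axis i 1))
      - (f (a + h *\<^sub>R axis j 1 + 0 *\<^sub>R axis i 1) - f (a + 0 *\<^sub>R axis i 1))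
     = h * (partial_on S i f (a + h *\<^sub>R axis j 1 + \<xi> *\<^sub>R axis i 1)
        - partial_on S i f (a + \<xi> *\<^sub>R axis i 1))"
    using mean_value_half_line[OF DERIV_diff[OF has_real_derivative_along_axis[OF S f aj]
          has_real_derivative_along_axis[OF S f a]] h] by blast
  have ai: "a + \<xi> *\<^sub>R axis i 1 \<in> S" using S a \<xi> by (auto intro: orthant_closedD)
  obtain \<eta> where \<eta>: "0 < \<eta>" "\<eta> < h"
    "partial_on S i f (a + \<xi> *\<^sub>R axis i 1 + h *\<^sub>R axis j 1)
       - partial_on S i f (a + \<xi> *\<^sub>R axis i 1 + 0 *\<^sub>R axis j 1)
     = h * partial_on S j (partial_on S i f) (a + \<xi> *\<^sub>R axis i 1 + \<eta> *\<^sub>R axis j 1)"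
    using mean_value_half_line[OF has_real_derivative_along_axis[OF S f' ai] h] by blast
  show ?thesis
    using \<xi> \<eta> by (intro exI[of _ \<xi>] exI[of _ \<eta>]) (simp add: add_ac)
qed

text \<open>Schwarz's argument: the second difference over a small square with corner
  \<open>a\<close> is symmetric in \<open>i\<close> and \<open>j\<close>, and equals
  \<open>h * h\<close> times either mixed partial at some point near \<open>a\<close>. If the two
  values at \<open>a\<close> differed, continuity would be contradicted for small
  \<open>h\<close>.\<close>

lemma partial_on_commute_real:
  fixes f :: "real ^ 'k::finite \<Rightarrow> real"
  assumes S: "orthant_closed S" and f: "C_times_on 2 S f" and a: "a \<in> S"
  shows "partial_on S j (partial_on S i f) a = partial_on S i (partial_on S j f) a"
proof (rule ccontr)
  define U where "U = partial_on S j (partial_on S i f)"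
  define V where "V = partial_on S i (partial_on S j f)"
  assume "\<not> ?thesis"
  then have pos: "\<bar>U a - V a\<bar> / 2 > 0" by (simp add: U_def V_def)
  have diff: "f differentiable_on S" "partial_on S k f differentiable_on S" for k
    using f by (auto simp: numeral_2_eq_2)
  have "continuous_on S U" "continuous_on S V"
    using f by (auto simp: numeral_2_eq_2 U_def V_def)
  then have lim: "(U \<longlongrightarrow> U a) (at a within S)" "(V \<longlongrightarrow> V a) (at a within S)"
    using a by (auto simp: continuous_on_def)
  obtain d1 where d1: "d1 > 0"
    and dU: "\<And>x. x \<in> S \<Longrightarrow> dist x a < d1 \<Longrightarrow> dist (U x) (U a) < \<bar>U a - V a\<bar> / 2"
    using tendstoD[OF lim(1) pos] pos unfolding eventually_at by (metis dist_self dist_pos_lt)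
  obtain d2 where d2: "d2 > 0"
    and dV: "\<And>x. x \<in> S \<Longrightarrow> dist x a < d2 \<Longrightarrow> dist (V x) (V a) < \<bar>U a - V a\<bar> / 2"
    using tendstoD[OF lim(2) pos] pos unfolding eventually_at by (metis dist_self dist_pos_lt)
  \<comment> \<open>The intermediate points lie within \<open>2 * h\<close> of \<open>a\<close>,
    hence within both \<open>d1\<close> and \<open>d2\<close>.\<close>
  define h where "h = min d1 d2 / 2"
  have h: "h > 0" "2 * h \<le> d1" "2 * h \<le> d2" using d1 d2 by (auto simp: h_def)
  have near: "a + s *\<^sub>R axis p 1 + t *\<^sub>R axis q 1 \<in> S"
      "dist (a + s *\<^sub>R axis p 1 + t *\<^sub>R axis q 1) a < 2 * h"
    if "0 < s" "s < h" "0 < t" "t < h" for s t and p q :: 'k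
  proof -
    show "a + s *\<^sub>R axis p 1 + t *\<^sub>R axis q 1 \<in> S"
      using S a that by (auto intro!: orthant_closedD)
    have "norm (s *\<^sub>R axis p 1 + t *\<^sub>R axis q (1::real) :: real ^ 'k) \<le> s + t"
      using that by (intro norm_triangle_le) (simp add: norm_axis_1)
    then show "dist (a + s *\<^sub>R axis p 1 + t *\<^sub>R axis q 1) a < 2 * h"
      using that by (simp add: dist_norm add.assoc)
  qed
  obtain s t where st: "0 < s" "s < h" "0 < t" "t < h"
    "f (a + h *\<^sub>R axis j 1 + h *\<^sub>R axis i 1) - f (a + h *\<^sub>R axis i 1)
      - f (a + h *\<^sub>R axis j 1) + f a = h * (h * U (a + s *\<^sub>R axis i 1 + t *\<^sub>R axis j 1))"
    using second_difference_mean_value[OF S diff a h(1), of j i, folded U_def]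
    by (elim exE conjE)
  obtain s' t' where st': "0 < s'" "s' < h" "0 < t'" "t' < h"
    "f (a + h *\<^sub>R axis i 1 + h *\<^sub>R axis j 1) - f (a + h *\<^sub>R axis j 1)
      - f (a + h *\<^sub>R axis i 1) + f a = h * (h * V (a + s' *\<^sub>R axis j 1 + t' *\<^sub>R axis i 1))"
    using second_difference_mean_value[OF S diff a h(1), of i j, folded V_def]
    by (elim exE conjE)
  have "h * (h * U (a + s *\<^sub>R axis i 1 + t *\<^sub>R axis j 1))
      = h * (h * V (a + s' *\<^sub>R axis j 1 + t' *\<^sub>R axis i 1))"
    unfolding st(5)[symmetric] st'(5)[symmetric] by (simp add: add_ac)
  then have eq: "U (a + s *\<^sub>R axis i 1 + t *\<^sub>R axis j 1) = V (a + s' *\<^sub>R axis j 1 + t' *\<^sub>R axis i 1)"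
    using h(1) by simp
  have "dist (U (a + s *\<^sub>R axis i 1 + t *\<^sub>R axis j 1)) (U a) < \<bar>U a - V a\<bar> / 2"
    by (rule dU[OF near(1)[OF st(1-4)] less_le_trans[OF near(2)[OF st(1-4)] h(2)]])
  moreover have "dist (V (a + s' *\<^sub>R axis j 1 + t' *\<^sub>R axis i 1)) (V a) < \<bar>U a - V a\<bar> / 2"
    by (rule dV[OF near(1)[OF st'(1-4)] less_le_trans[OF near(2)[OF st'(1-4)] h(3)]])
  ultimately have "dist (U a) (V a) < \<bar>U a - V a\<bar>"
    unfolding eq by (rule dist_triangle_half_r)
  then show False by (simp add: dist_real_def)
qed

text \<open>Reduces to real-valued functions by pairing with basis vectors, which commutes with
  partial derivatives.\<close>

lemma partial_on_commute:
  fixes f :: "real ^ 'k::finite \<Rightarrow> 'a::euclidean_space"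
  assumes S: "orthant_closed S" and f: "C_times_on 2 S f" and a: "a \<in> S"
  shows "partial_on S j (partial_on S i f) a = partial_on S i (partial_on S j f) a"
proof (rule euclidean_eqI)
  fix b :: 'a
  have diff: "f differentiable_on S" "partial_on S k f differentiable_on S" for k
    using f by (auto simp: numeral_2_eq_2)
  have bl: "bounded_linear (\<lambda>v. v \<bullet> b)" by (rule bounded_linear_inner_left)
  have "partial_on S j (partial_on S i f) a \<bullet> b = partial_on S j (partial_on S i (\<lambda>x. f x \<bullet> b)) a" for i j
  proof -
    have "partial_on S j (partial_on S i f) a \<bullet> b = partial_on S j (\<lambda>x. partial_on S i f x \<bullet> b) a"
      using partial_on_linear[OF S diff(2) a bl] by simp
    also have "\<dots> = partial_on S j (partial_on S i (\<lambda>x. f x \<bullet> b)) a"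
      by (rule partial_on_cong[OF _ a]) (simp add: partial_on_linear[OF S diff(1) _ bl])
    finally show ?thesis .
  qed
  then show "partial_on S j (partial_on S i f) a \<bullet> b = partial_on S i (partial_on S j f) a \<bullet> b"
    using partial_on_commute_real[OF S C_times_on_linear[OF S bl f] a] by simp
qed

section \<open>The residue polynomials\<close>

text \<open>The prefactor times the coefficient of the \<open>j\<close>-th term, with the quotient
  of the two Pochhammer symbols already cancelled. It is therefore polynomial in \<open>a\<close>
  and meaningful at the poles too.\<close>

definition residue_coeff :: "nat \<Rightarrow> complex \<Rightarrow> nat \<Rightarrow> complex" where
  "residue_coeff K a j =
     2 ^ K * fact (K div 2) / (2 ^ j * fact (j div 2) * fact (K - j)) *
     pochhammer (a + of_nat ((j + 1) div 2)) ((K + 1) div 2 - (j + 1) div 2)"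

definition residue_poly :: "nat \<Rightarrow> complex \<Rightarrow> complex poly" where
  "residue_poly K a = (\<Sum>j\<le>K. monom (residue_coeff K a j) j)"

abbreviation reflect :: "'a::comm_ring_1 poly \<Rightarrow> 'a poly" where
  "reflect p \<equiv> pcompose p [:0, -1:]"

lemma coeff_reflect: "coeff (reflect p) j = (- 1) ^ j * coeff p j" for p :: "'a::idom poly"
  using coeff_pcompose_linear[of p "-1::'a" j] by simp

lemma degree_reflect: "degree (reflect p) = degree p" for p :: "'a::idom poly"
  by (simp add: degree_pcompose)

lemma coeff_residue_poly: "coeff (residue_poly K a) j = (if j \<le> K then residue_coeff K a j else 0)"
  by (simp add: residue_poly_def coeff_sum coeff_monom)

lemma degree_residue_poly_le: "degree (residue_poly K a) \<le> K"
  by (rule degree_le) (simp add: coeff_residue_poly)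

lemma residue_coeff_top [simp]: "residue_coeff K a K = 1"
  by (simp add: residue_coeff_def)

text \<open>For \<open>j = 2 * l\<close>, passing to \<open>j + 1\<close> removes the lowest
  Pochhammer factor \<open>a + l\<close> and keeps \<open>fact (j div 2)\<close>. For odd
  \<open>j\<close> the Pochhammer symbol stays and the factorial grows instead. The powers of 2 turn
  these factors into \<open>2 * a + j\<close> and \<open>j + 1\<close>.\<close>

lemma residue_coeff_Suc:
  assumes "j < K"
  shows "(if even j then 2 * a + of_nat j else of_nat (j + 1)) * residue_coeff K a (Suc j)
    = of_nat (K - j) * residue_coeff K a j"
proof -
  obtain m where m: "K - j = Suc m" "K - Suc j = m"
    using assms by (metis Suc_diff_Suc)
  have f: "(fact (Suc m) :: complex) = of_nat (Suc m) * fact m" by (rule fact_Suc)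
  show ?thesis
  proof (cases "even j")
    case True
    then obtain l where l: "j = 2 * l" by blast
    then have "(K + 1) div 2 - l = Suc ((K + 1) div 2 - Suc l)" using assms by linarith
    then have "pochhammer (a + of_nat l) ((K + 1) div 2 - l)
        = (a + of_nat l) * pochhammer (a + of_nat (Suc l)) ((K + 1) div 2 - Suc l)"
      by (simp add: pochhammer_rec add_ac)
    then show ?thesis
      using l m f by (simp add: residue_coeff_def field_simps del: of_nat_Suc fact_Suc)
  next
    case False
    then obtain l where l: "j = 2 * l + 1" by (blast elim: oddE)
    have "(fact (Suc l) :: complex) = of_nat (Suc l) * fact l" by (rule fact_Suc)
    moreover have "of_nat (j + 1) = 2 * (of_nat (Suc l) :: complex)" by (simp add: l)
    ultimately show ?thesis
      using l m f by (simp add: residue_coeff_def field_simps del: of_nat_Suc fact_Suc)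
  qed
qed

text \<open>
  This is \<open>x\<close> times the equation \<open>T f = K f - x f'\<close> for the Dunkl operator \<open>T f = f' + k (f - reflect f) / x\<close>.
\<close>

definition dunkl_eq :: "nat \<Rightarrow> 'a::idom \<Rightarrow> 'a poly \<Rightarrow> bool" where
  "dunkl_eq K k f \<longleftrightarrow>
     [:0, 1, 1:] * pderiv f + smult k (f - reflect f) = smult (of_nat K) ([:0, 1:] * f)"

text \<open>Compares coefficients of degree \<open>Suc j\<close>; in degree 0 both sides vanish.
  Only odd coefficients survive in \<open>f - reflect f\<close>, doubled, so \<open>2 * k\<close>
  appears exactly for even \<open>j\<close>.\<close>

lemma dunkl_eq_iff_coeff:
  "dunkl_eq K k f \<longleftrightarrow> (\<forall>j. (of_nat (Suc j) + (if even j then 2 * k else 0)) * coeff f (Suc j)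
      = (of_nat K - of_nat j) * coeff f j)"
proof -
  have X: "[:0, 1, 1:] * p = pCons 0 (p + pCons 0 p)" "[:0, 1:] * p = pCons 0 p" for p :: "'a poly"
    by simp_all
  have co: "coeff ([:0, 1, 1:] * pderiv f + smult k (f - reflect f)) (Suc j)
      = (of_nat (Suc j) + (if even j then 2 * k else 0)) * coeff f (Suc j) + of_nat j * coeff f j" for j
    unfolding X by (cases j) (auto simp: coeff_pderiv coeff_reflect algebra_simps)
  have co': "coeff (smult (of_nat K) ([:0, 1:] * f)) (Suc j) = of_nat K * coeff f j" for j
    by simp
  have "coeff ([:0, 1, 1:] * pderiv f + smult k (f - reflect f)) 0
      = coeff (smult (of_nat K) ([:0, 1:] * f)) 0"
    unfolding X by (simp add: poly_0_coeff_0)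
  then have "dunkl_eq K k f \<longleftrightarrow> (\<forall>j. coeff ([:0, 1, 1:] * pderiv f + smult k (f - reflect f)) (Suc j)
      = coeff (smult (of_nat K) ([:0, 1:] * f)) (Suc j))"
    unfolding dunkl_eq_def poly_eq_iff by (metis not0_implies_Suc)
  also have "\<dots> \<longleftrightarrow> (\<forall>j. (of_nat (Suc j) + (if even j then 2 * k else 0)) * coeff f (Suc j)
      = (of_nat K - of_nat j) * coeff f j)"
    unfolding co co' by (auto simp: algebra_simps)
  finally show ?thesis .
qed

lemma dunkl_eq_residue_poly: "dunkl_eq K (a - 1/2) (residue_poly K a)"
  unfolding dunkl_eq_iff_coeff
proof
  fix j
  show "(of_nat (Suc j) + (if even j then 2 * (a - 1/2) else 0)) * coeff (residue_poly K a) (Suc j)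
      = (of_nat K - of_nat j) * coeff (residue_poly K a) j"
  proof (cases "j < K")
    case True
    then show ?thesis
      using residue_coeff_Suc[OF True, of a]
      by (auto simp: coeff_residue_poly algebra_simps of_nat_diff)
  qed (auto simp: coeff_residue_poly)
qed

text \<open>The recursion is run downwards from the leading coefficient: its factor
  \<open>K - j\<close> is nonzero for \<open>j < K\<close> whatever \<open>a\<close> is, so each
  coefficient determines the one below.\<close>

lemma residue_poly_unique:
  assumes eq: "dunkl_eq K (a - 1/2) f" and deg: "degree f \<le> K" and lead: "coeff f K = 1"
  shows "f = residue_poly K a"
proof -
  have "i \<le> K \<Longrightarrow> coeff f (K - i) = coeff (residue_poly K a) (K - i)" for i
  proof (induction i)
    case 0
    then show ?case by (simp add: lead coeff_residue_poly)
  next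
    case (Suc i)
    define j where "j = K - Suc i"
    have j: "K - i = Suc j" "j < K" using Suc.prems by (auto simp: j_def)
    then have "coeff f (Suc j) = coeff (residue_poly K a) (Suc j)" using Suc by simp
    then have "(of_nat K - of_nat j) * coeff f j = (of_nat K - of_nat j) * coeff (residue_poly K a) j"
      using eq dunkl_eq_residue_poly[of K a] unfolding dunkl_eq_iff_coeff by metis
    moreover have "(of_nat K :: complex) \<noteq> of_nat j" using j by simp
    ultimately show ?case by (simp add: j_def)
  qed
  note low = this
  show ?thesis
  proof (rule poly_eqI)
    fix j show "coeff f j = coeff (residue_poly K a) j"
    proof (cases "j \<le> K")
      case True
      then show ?thesis using low[of "K - j"] by simp
    next
      case False
      then show ?thesis using deg by (simp add: coeff_eq_0 coeff_residue_poly)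
    qed
  qed
qed

lemma dunkl_eq_poly:
  "dunkl_eq K k f \<longleftrightarrow> (\<forall>x. x * (1 + x) * poly (pderiv f) x + k * (poly f x - poly f (- x))
      = of_nat K * x * poly f x)" for f :: "'a::{idom, ring_char_0} poly"
  unfolding dunkl_eq_def poly_eq_poly_eq_iff[symmetric] fun_eq_iff
  by (simp add: poly_pcompose algebra_simps)

text \<open>Let \<open>h\<close> be the factor multiplying \<open>reflect f\<close>. Inserting the
  equation of \<open>f\<close> at \<open>- x\<close> cancels the terms with \<open>poly f x\<close>.
  What remains is \<open>x * poly f (- x) * poly h x\<close> times a polynomial of degree at most 1
  in \<open>x\<close>, both of whose coefficients vanish for the given \<open>k\<close> and the new
  degree.\<close>

lemma dunkl_eq_raise:
  fixes f :: "complex poly"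
  assumes f: "dunkl_eq L k f" and k: "k = of_nat M - of_nat (L + 2 * M + 1)"
  shows "dunkl_eq (L + 2 * M + 1) k (reflect f * [:-1, 0, 1:] ^ M * [:1, -1:])"
proof -
  define h where "h = [:-1, 0, 1:] ^ M * [:1, -1 :: complex:]"
  define g where "g = reflect f * h"
  define r where "r = [:0, 1, 1:] * pderiv g + smult k (g - reflect g)
    - smult (of_nat (L + 2 * M + 1)) ([:0, 1:] * g)"
  have g': "pderiv g = reflect f * pderiv h - reflect (pderiv f) * h"
    by (simp add: g_def pderiv_mult pderiv_pcompose pderiv_pCons algebra_simps)
  \<comment> \<open>The factor \<open>1 - x\<close> clears the denominators in
    \<open>h(-x) / h(x) = (1 + x) / (1 - x)\<close> and in the logarithmic derivative of
    \<open>h\<close>.\<close>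
  have "poly ([:1, -1:] * r) x = 0" for x
  proof -
    have hr: "(1 - x) * poly h (- x) = (1 + x) * poly h x"
      by (simp add: h_def poly_power algebra_simps)
    have h': "(1 - x) * (1 + x) * poly (pderiv h) x
        = - (1 + x) * poly h x - 2 * of_nat M * x * poly h x"
    proof (cases M)
      case (Suc m)
      define q where "q = poly ([:-1, 0, 1:] ^ m) x"
      have "poly h x = (x * x - 1) * q * (1 - x)"
        by (simp add: h_def Suc q_def algebra_simps)
      moreover have "poly (pderiv h) x = of_nat M * q * (2 * x) * (1 - x) - (x * x - 1) * q"
        by (simp add: h_def Suc q_def pderiv_mult pderiv_power_Suc pderiv_pCons algebra_simps
            del: mult_pCons_left mult_pCons_right power_Suc) (simp add: algebra_simps)
      ultimately show ?thesis by algebra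
    qed (simp add: h_def pderiv_pCons algebra_simps)
    have f': "- x * (1 - x) * poly (pderiv f) (- x) + k * (poly f (- x) - poly f x)
      = - (of_nat L * x * poly f (- x))"
      using f[unfolded dunkl_eq_poly, rule_format, of "- x"] by simp
    have "poly r x = x * (1 + x) * poly (pderiv g) x + k * (poly g x - poly g (- x))
        - of_nat (L + 2 * M + 1) * x * poly g x"
      by (simp add: r_def poly_pcompose algebra_simps)
    moreover have "poly g x = poly f (- x) * poly h x" "poly g (- x) = poly f x * poly h (- x)"
      "poly (pderiv g) x = poly f (- x) * poly (pderiv h) x - poly (pderiv f) (- x) * poly h x"
      unfolding g' by (simp_all add: g_def poly_pcompose)
    moreover have "k = - of_nat L - of_nat M - 1" "of_nat (L + 2 * M + 1) = of_nat L + 2 * of_nat M + (1::complex)"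
      by (simp_all add: k)
    ultimately have "(1 - x) * poly r x = 0"
      using hr h' f' by algebra
    then show ?thesis by auto
  qed
  then have "[:1, -1:] * r = 0" by (meson poly_all_0_iff_0)
  then have "r = 0" by (simp del: mult_pCons_left)
  then have "dunkl_eq (L + 2 * M + 1) k g" by (simp add: dunkl_eq_def r_def)
  then show ?thesis unfolding g_def h_def mult.assoc .
qed

text \<open>The value of \<open>a\<close> is the one for which \<open>a - 1/2 = M - K\<close>, as
  \<open>dunkl_eq_raise\<close> demands; the right-hand side is then a monic solution of degree
  \<open>K\<close>, and uniqueness applies.\<close>

lemma residue_poly_factor:
  assumes "K = L + 2 * M + 1" and "a = 1/2 + of_nat M - of_nat K"
  shows "residue_poly K a
    = smult ((- 1) ^ K) (reflect (residue_poly L a) * [:-1, 0, 1:] ^ M * [:1, -1:])"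
proof (rule residue_poly_unique[symmetric])
  define g where "g = reflect (residue_poly L a) * [:-1, 0, 1:] ^ M * [:1, -1:]"
  have "dunkl_eq K (a - 1/2) g"
    unfolding assms(1) g_def
    by (rule dunkl_eq_raise[OF dunkl_eq_residue_poly]) (simp add: assms)
  then show "dunkl_eq K (a - 1/2) (smult ((- 1) ^ K) g)"
    unfolding dunkl_eq_iff_coeff by (metis (no_types, lifting) coeff_smult mult.left_commute)
  have deg: "degree (residue_poly L a) = L"
    by (rule antisym[OF degree_residue_poly_le le_degree]) (simp add: coeff_residue_poly)
  then have lead: "lead_coeff (reflect (residue_poly L a)) = (- 1) ^ L"
    by (simp add: degree_reflect deg coeff_reflect coeff_residue_poly del: lead_coeff_comp)
  then have nz: "reflect (residue_poly L a) \<noteq> 0" by auto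
  have degg: "degree g = K"
    using nz by (simp add: g_def degree_mult_eq degree_power_eq degree_reflect deg assms(1)
        del: mult_pCons_left mult_pCons_right)
  then show "degree (smult ((- 1) ^ K) g) \<le> K" by simp
  \<comment> \<open>Reflection contributes \<open>(- 1) ^ L\<close> and the factor
    \<open>1 - x\<close> contributes \<open>- 1\<close>; since \<open>K\<close> and
    \<open>L + 1\<close> have equal parity, \<open>(- 1) ^ K\<close> makes the product
    monic.\<close>
  have "lead_coeff g = (- 1) ^ L * - 1"
    by (simp add: g_def lead_coeff_mult lead_coeff_power lead
        del: lead_coeff_comp mult_pCons_left mult_pCons_right)
  then show "coeff (smult ((- 1) ^ K) g) K = 1"
    by (simp add: degg assms(1) power_add power_mult flip: power_mult_distrib)
qed

section \<open>Dirac operator and boundary operator\<close>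

lemma bounded_linear_boundary_incl: "bounded_linear (boundary_incl :: real ^ 'm::finite \<Rightarrow> _)"
  by (auto intro!: linearI simp: boundary_incl_def vec_eq_iff split: option.split
      simp flip: linear_conv_bounded_linear)

lemma boundary_incl_axis: "boundary_incl (axis i 1) = axis (Some i) 1"
  by (auto simp: boundary_incl_def vec_eq_iff axis_def split: option.split)

lemma boundary_incl_in_upper_half_space [simp]: "boundary_incl y \<in> upper_half_space"
  by (simp add: boundary_incl_def upper_half_space_def)

text \<open>The inclusion maps all of the boundary space into the half-space, so the one-sided
  derivative pulls back to a full derivative.\<close>

lemma boundary_restr_has_derivative:
  assumes "\<psi> differentiable_on upper_half_space"
  shows "(boundary_restr \<psi> has_derivative
    (\<lambda>v. frechet_derivative \<psi> (at (boundary_incl y) within upper_half_space) (boundary_incl v))) (at y)"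
  unfolding boundary_restr_def
  by (rule has_derivative_in_compose)
    (auto intro!: bounded_linear_imp_has_derivative[OF bounded_linear_boundary_incl]
      has_derivative_subset[OF has_derivative_frechet_on[OF assms]])

lemma partial_on_boundary_restr:
  assumes "\<psi> differentiable_on upper_half_space"
  shows "partial_on UNIV i (boundary_restr \<psi>)
    = boundary_restr (partial_on upper_half_space (Some i) \<psi>)"
proof
  fix y
  show "partial_on UNIV i (boundary_restr \<psi>) y
    = boundary_restr (partial_on upper_half_space (Some i) \<psi>) y"
    using partial_on_eqI[OF orthant_closed_UNIV UNIV_I boundary_restr_has_derivative[OF assms]]
    by (simp add: boundary_incl_axis partial_on_def[of upper_half_space] boundary_restr_def)
qed

lemma C_times_on_boundary_restr:
  "C_times_on r upper_half_space \<psi> \<Longrightarrow> C_times_on r UNIV (boundary_restr \<psi>)"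
proof (induction r arbitrary: \<psi>)
  case 0
  have "continuous_on UNIV (\<lambda>y. \<psi> (boundary_incl y))"
    by (rule continuous_on_compose2[of upper_half_space])
      (use 0 linear_continuous_on[OF bounded_linear_boundary_incl] in auto)
  then show ?case by (simp add: boundary_restr_def)
next
  case (Suc r)
  then show ?case
    using boundary_restr_has_derivative[of \<psi>]
    by (auto simp: partial_on_boundary_restr differentiable_on_def intro: differentiableI)
qed

lemma smooth_boundary_restr:
  "smooth_on_set upper_half_space \<psi> \<Longrightarrow> smooth_on_set UNIV (boundary_restr \<psi>)"
  by (simp add: smooth_on_set_def C_times_on_boundary_restr)

lemma smooth_normal_deriv:
  "smooth_on_set upper_half_space \<psi> \<Longrightarrow> smooth_on_set upper_half_space (normal_deriv \<psi>)"
  by (simp add: normal_deriv_def smooth_on_set_partial_on)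

lemma smooth_normal_deriv_funpow:
  "smooth_on_set upper_half_space \<psi> \<Longrightarrow> smooth_on_set upper_half_space ((normal_deriv ^^ m) \<psi>)"
  by (induction m) (simp_all add: smooth_normal_deriv)

lemma normal_deriv_cong:
  assumes "\<And>x. x \<in> upper_half_space \<Longrightarrow> \<phi> x = \<psi> x" "x \<in> upper_half_space"
  shows "normal_deriv \<phi> x = normal_deriv \<psi> x"
  unfolding normal_deriv_def by (rule partial_on_cong[OF assms])

text \<open>Treats normal and tangential directions alike, so that smoothness and commutation need
  no case split.\<close>

lemma dirac_eq_sum:
  "dirac e \<psi> = (\<lambda>x. \<Sum>k\<in>UNIV. e k *v partial_on upper_half_space k \<psi> x)"
  by (simp add: fun_eq_iff dirac_def D_tangential_def D_normal_def normal_deriv_def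
      UNIV_option_conv sum.reindex o_def add.commute)

lemma smooth_dirac:
  fixes \<psi> :: "real ^ ('m::finite option) \<Rightarrow> complex ^ 's::finite"
  assumes "smooth_on_set upper_half_space \<psi>"
  shows "smooth_on_set upper_half_space (dirac e \<psi>)"
  unfolding dirac_eq_sum
  by (intro smooth_on_set_sum smooth_on_set_linear[OF _ matrix_vector_mul_bounded_linear]
      smooth_on_set_partial_on assms) simp_all

lemma smooth_dirac_funpow:
  fixes \<psi> :: "real ^ ('m::finite option) \<Rightarrow> complex ^ 's::finite"
  shows "smooth_on_set upper_half_space \<psi> \<Longrightarrow> smooth_on_set upper_half_space ((dirac e ^^ m) \<psi>)"
  by (induction m) (simp_all add: smooth_dirac)

text \<open>The Clifford matrices are constant and mixed partials commute.\<close>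

lemma normal_deriv_dirac:
  fixes \<psi> :: "real ^ ('m::finite option) \<Rightarrow> complex ^ 's::finite"
  assumes \<psi>: "smooth_on_set upper_half_space \<psi>" and x: "x \<in> upper_half_space"
  shows "normal_deriv (dirac e \<psi>) x = dirac e (normal_deriv \<psi>) x"
proof -
  let ?H = "upper_half_space :: (real ^ ('m option)) set"
  have d: "partial_on ?H k \<psi> differentiable_on ?H" for k
    using \<psi> by (intro smooth_on_set_differentiable smooth_on_set_partial_on)
  have d': "(\<lambda>x. e k *v partial_on ?H k \<psi> x) differentiable_on ?H" for k
    using \<psi> by (intro smooth_on_set_differentiable smooth_on_set_partial_on
        smooth_on_set_linear[OF _ matrix_vector_mul_bounded_linear]) simp_all
  show ?thesis
    unfolding normal_deriv_def dirac_eq_sum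
    by (simp add: partial_on_sum[OF _ d' x]
        partial_on_linear[OF _ d x matrix_vector_mul_bounded_linear]
        partial_on_commute[OF _ smooth_on_set_C_times_on[OF \<psi>] x, of None])
qed

lemma normal_deriv_funpow_dirac:
  fixes \<psi> :: "real ^ ('m::finite option) \<Rightarrow> complex ^ 's::finite"
  assumes \<psi>: "smooth_on_set upper_half_space \<psi>"
  shows "x \<in> upper_half_space \<Longrightarrow> (normal_deriv ^^ m) (dirac e \<psi>) x = dirac e ((normal_deriv ^^ m) \<psi>) x"
proof (induction m arbitrary: x)
  case (Suc m)
  have "normal_deriv ((normal_deriv ^^ m) (dirac e \<psi>)) x = normal_deriv (dirac e ((normal_deriv ^^ m) \<psi>)) x"
    by (rule normal_deriv_cong) (use Suc in auto)
  then show ?case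
    by (simp add: normal_deriv_dirac smooth_normal_deriv_funpow \<psi> Suc.prems)
qed simp

definition boundary_jet ::
    "nat \<Rightarrow> (real ^ ('m::finite option) \<Rightarrow> complex ^ 's) \<Rightarrow> real ^ 'm \<Rightarrow> complex ^ 's" where
  "boundary_jet m \<psi> = boundary_restr ((normal_deriv ^^ m) \<psi>)"

lemma smooth_boundary_jet:
  "smooth_on_set upper_half_space \<psi> \<Longrightarrow> smooth_on_set UNIV (boundary_jet m \<psi>)"
  unfolding boundary_jet_def by (intro smooth_boundary_restr smooth_normal_deriv_funpow)

section \<open>Clifford relations and the Dirac operator on normal jets\<close>

lemma clifford_square:
  fixes e :: "'k::finite \<Rightarrow> complex ^ 's::finite ^ 's"
  assumes "spinor_module e"
  shows "e k *v (e k *v v) = - v"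
proof -
  have "e k ** e k + e k ** e k = mat (- 2)"
    using assms by (simp add: spinor_module_def)
  then have "(e k ** e k + e k ** e k) *v v = mat (- 2) *v v" by simp
  also have "mat (- 2) *v v = 2 *\<^sub>R (- v)"
    by (simp add: vec_eq_iff scaleR_conv_of_real matrix_vector_mult_def mat_def if_distrib[of "\<lambda>x. x * _"] cong: if_cong)
  finally have "2 *\<^sub>R (e k *v (e k *v v)) = 2 *\<^sub>R (- v)"
    by (simp only: scaleR_2 matrix_vector_mult_add_rdistrib matrix_vector_mul_assoc)
  then show ?thesis by (simp only: scaleR_cancel_left) simp
qed

lemma clifford_anticommute:
  fixes e :: "'k::finite \<Rightarrow> complex ^ 's::finite ^ 's"
  assumes "spinor_module e" and "i \<noteq> j"
  shows "e i *v (e j *v v) = - (e j *v (e i *v v))"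
proof -
  have "e i ** e j + e j ** e i = 0"
    using assms by (simp add: spinor_module_def)
  then have "(e i ** e j + e j ** e i) *v v = 0" by simp
  then show ?thesis
    by (simp add: matrix_vector_mult_add_rdistrib matrix_vector_mul_assoc eq_neg_iff_add_eq_0)
qed

text \<open>Since \<open>e None\<close> squares to \<open>- 1\<close>, the tangential part of the
  Dirac operator is \<open>- e None\<close> times the boundary operator.\<close>

lemma boundary_jet_dirac:
  fixes \<psi> :: "real ^ ('m::finite option) \<Rightarrow> complex ^ 's::finite"
  assumes e: "spinor_module e" and \<psi>: "smooth_on_set upper_half_space \<psi>"
  shows "boundary_jet m (dirac e \<psi>)
    = (\<lambda>y. e None *v (boundary_jet (Suc m) \<psi> y - D_boundary e (boundary_jet m \<psi>) y))"
proof
  fix y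
  have d: "(normal_deriv ^^ m) \<psi> differentiable_on upper_half_space"
    by (intro smooth_on_set_differentiable smooth_normal_deriv_funpow \<psi>)
  have "boundary_jet m (dirac e \<psi>) y = dirac e ((normal_deriv ^^ m) \<psi>) (boundary_incl y)"
    by (simp add: boundary_jet_def boundary_restr_def normal_deriv_funpow_dirac[OF \<psi>])
  also have "\<dots> = (\<Sum>i\<in>UNIV. e (Some i) *v partial_on UNIV i (boundary_jet m \<psi>) y)
      + e None *v boundary_jet (Suc m) \<psi> y"
    by (simp add: dirac_def D_tangential_def D_normal_def boundary_jet_def
        partial_on_boundary_restr[OF d, unfolded boundary_restr_def] boundary_restr_def)
  also have "\<dots> = e None *v (boundary_jet (Suc m) \<psi> y - D_boundary e (boundary_jet m \<psi>) y)"
    by (simp add: D_boundary_def matrix_vector_mult_diff_distrib clifford_square[OF e])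
  finally show "boundary_jet m (dirac e \<psi>) y
    = e None *v (boundary_jet (Suc m) \<psi> y - D_boundary e (boundary_jet m \<psi>) y)" .
qed

lemma smooth_D_boundary:
  fixes \<phi> :: "real ^ 'm::finite \<Rightarrow> complex ^ 's::finite"
  assumes "smooth_on_set UNIV \<phi>"
  shows "smooth_on_set UNIV (D_boundary e \<phi>)"
  unfolding D_boundary_def
  by (intro smooth_on_set_sum smooth_on_set_linear[OF _ matrix_vector_mul_bounded_linear]
      smooth_on_set_partial_on assms) simp_all

text \<open>\<open>e None\<close> anticommutes with the boundary operator; swapping the two terms
  absorbs the sign. A difference is the form in which \<open>boundary_jet_dirac\<close> delivers its
  result, and the swap keeps that form for iteration.\<close>

lemma D_boundary_clifford_diff:
  fixes \<phi> \<eta> :: "real ^ 'm::finite \<Rightarrow> complex ^ 's::finite"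
  assumes e: "spinor_module e" and \<phi>: "smooth_on_set UNIV \<phi>" and \<eta>: "smooth_on_set UNIV \<eta>"
  shows "D_boundary e (\<lambda>y. e None *v (\<phi> y - \<eta> y))
    = (\<lambda>y. e None *v (D_boundary e \<eta> y - D_boundary e \<phi> y))"
proof
  fix y
  have d: "\<phi> differentiable_on UNIV" "\<eta> differentiable_on UNIV"
      "(\<lambda>y. \<phi> y - \<eta> y) differentiable_on UNIV"
    by (intro smooth_on_set_differentiable smooth_on_set_diff orthant_closed_UNIV \<phi> \<eta>)+
  have "partial_on UNIV i (\<lambda>y. e None *v (\<phi> y - \<eta> y)) y
      = e None *v (partial_on UNIV i \<phi> y - partial_on UNIV i \<eta> y)" for i
    by (simp add: partial_on_linear[OF _ d(3) _ matrix_vector_mul_bounded_linear]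
        partial_on_diff[OF _ d(1,2)])
  then show "D_boundary e (\<lambda>y. e None *v (\<phi> y - \<eta> y)) y
    = e None *v (D_boundary e \<eta> y - D_boundary e \<phi> y)"
    by (simp add: D_boundary_def clifford_square[OF e] clifford_anticommute[OF e, of "Some _" None]
        matrix_vector_mult_diff_distrib sum_negf sum_subtractf
        vec.linear_sum[OF matrix_vector_mul_linear_gen] vec.linear_neg[OF matrix_vector_mul_linear_gen])
qed

lemma D_boundary_funpow_clifford_diff:
  fixes \<phi> \<eta> :: "real ^ 'm::finite \<Rightarrow> complex ^ 's::finite"
  assumes e: "spinor_module e"
  shows "smooth_on_set UNIV \<phi> \<Longrightarrow> smooth_on_set UNIV \<eta> \<Longrightarrow>
    (D_boundary e ^^ j) (\<lambda>y. e None *v (\<phi> y - \<eta> y)) y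
    = (- 1) ^ j *s (e None *v ((D_boundary e ^^ j) \<phi> y - (D_boundary e ^^ j) \<eta> y))"
proof (induction j arbitrary: \<phi> \<eta>)
  case (Suc j)
  let ?v = "(D_boundary e ^^ j) (D_boundary e \<phi>) y" and ?w = "(D_boundary e ^^ j) (D_boundary e \<eta>) y"
  have "(D_boundary e ^^ Suc j) (\<lambda>y. e None *v (\<phi> y - \<eta> y)) y = (- 1) ^ j *s (e None *v (?w - ?v))"
    by (simp add: funpow_Suc_right D_boundary_clifford_diff[OF e Suc.prems]
        Suc.IH smooth_D_boundary Suc.prems del: funpow.simps)
  also have "e None *v (?w - ?v) = - (e None *v (?v - ?w))"
    by (simp add: matrix_vector_mult_diff_distrib)
  finally show ?case
    by (simp add: funpow_Suc_right vec_eq_iff del: funpow.simps)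
qed simp

text \<open>
  The homogenisation of \<open>p\<close> in degree \<open>K\<close>, evaluated at the boundary operator and the normal derivative.
\<close>

definition boundary_eval ::
    "('m::finite option \<Rightarrow> complex ^ 's ^ 's) \<Rightarrow> complex poly \<Rightarrow> nat \<Rightarrow>
     (real ^ ('m option) \<Rightarrow> complex ^ 's) \<Rightarrow> real ^ 'm \<Rightarrow> complex ^ 's" where
  "boundary_eval e p K \<psi> y =
     (\<Sum>j\<le>K. coeff p j *s (D_boundary e ^^ j) (boundary_jet (K - j) \<psi>) y)"

section \<open>Composition with powers of the Dirac operator as polynomial multiplication\<close>

lemma boundary_eval_smult: "boundary_eval e (smult c p) K \<psi> y = c *s boundary_eval e p K \<psi> y"
  by (simp add: boundary_eval_def vec_eq_iff sum_distrib_left mult.assoc)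

text \<open>Moving \<open>e None\<close> to the left past the \<open>j\<close>-th power of the
  boundary operator costs \<open>(- 1) ^ j\<close>, which reflects \<open>p\<close>; the remaining
  difference of normal derivative and boundary operator is the factor \<open>1 - x\<close>.\<close>

lemma boundary_eval_dirac:
  fixes e :: "'m::finite option \<Rightarrow> complex ^ 's::finite ^ 's"
  assumes e: "spinor_module e" and \<psi>: "smooth_on_set upper_half_space \<psi>" and p: "degree p \<le> K"
  shows "boundary_eval e p K (dirac e \<psi>) y
    = e None *v boundary_eval e (reflect p * [:1, -1:]) (Suc K) \<psi> y"
proof -
  define F where "F j = (D_boundary e ^^ j) (boundary_jet (Suc K - j) \<psi>) y" for j
  define q where "q = reflect p"
  have "(D_boundary e ^^ j) (boundary_jet (K - j) (dirac e \<psi>)) y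
      = (- 1) ^ j *s (e None *v (F j - F (Suc j)))" if "j \<le> K" for j
    using that \<psi> by (simp add: boundary_jet_dirac[OF e \<psi>] D_boundary_funpow_clifford_diff[OF e]
        smooth_boundary_jet smooth_D_boundary F_def Suc_diff_le funpow_Suc_right del: funpow.simps)
  then have "boundary_eval e p K (dirac e \<psi>) y
      = (\<Sum>j\<le>K. coeff p j *s ((- 1) ^ j *s (e None *v (F j - F (Suc j)))))"
    unfolding boundary_eval_def by (intro sum.cong) auto
  also have "\<dots> = e None *v (\<Sum>j\<le>K. coeff q j *s (F j - F (Suc j)))"
    by (simp only: vec.linear_sum[OF matrix_vector_mul_linear_gen] vector_scalar_commute
        vector_smult_assoc q_def coeff_reflect mult.commute)
  \<comment> \<open>The bound on \<open>degree p\<close> makes the coefficient of \<open>q\<close>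
    at \<open>Suc K\<close> zero, so the first sum may be extended; the second becomes the shifted
    part of the product with \<open>1 - x\<close>.\<close>
  also have "(\<Sum>j\<le>K. coeff q j *s (F j - F (Suc j)))
      = (\<Sum>j\<le>Suc K. coeff q j *s F j) - (\<Sum>j\<le>K. coeff q j *s F (Suc j))"
    using p by (simp add: q_def coeff_reflect coeff_eq_0 sum_subtractf vector_ssub_ldistrib)
  also have "\<dots> = (\<Sum>j\<le>Suc K. coeff (q * [:1, -1:]) j *s F j)"
    unfolding sum.atMost_Suc_shift
    by (simp add: sum_subtractf[symmetric] vec.scale_left_diff_distrib)
  finally show ?thesis by (simp add: boundary_eval_def F_def q_def)
qed

lemma boundary_eval_dirac_even_power:
  fixes e :: "'m::finite option \<Rightarrow> complex ^ 's::finite ^ 's"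
  assumes e: "spinor_module e" and \<psi>: "smooth_on_set upper_half_space \<psi>"
  shows "degree p \<le> K \<Longrightarrow> boundary_eval e p K ((dirac e ^^ (2 * M)) \<psi>) y
    = boundary_eval e (p * [:-1, 0, 1:] ^ M) (K + 2 * M) \<psi> y"
proof (induction M arbitrary: p K)
  case (Suc M)
  let ?\<psi> = "(dirac e ^^ (2 * M)) \<psi>"
  have deg: "degree (reflect p * [:1, -1:]) \<le> Suc K"
    using Suc.prems degree_mult_le[of "reflect p" "[:1, -1:]"]
    by (simp add: degree_reflect del: mult_pCons_left mult_pCons_right)
  have deg2: "degree (p * [:-1, 0, 1:]) \<le> Suc (Suc K)"
    using Suc.prems degree_mult_le[of p "[:-1, 0, 1:]"] by (simp del: mult_pCons_left mult_pCons_right)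
  \<comment> \<open>Reflecting twice restores \<open>p\<close> and turns one factor into
    \<open>1 + x\<close>. The sign in front is later cancelled by the square of
    \<open>e None\<close>.\<close>
  have q: "reflect (reflect p * [:1, -1:]) * [:1, -1:] = smult (- 1) (p * [:-1, 0, 1:])"
    by (simp add: poly_eq_poly_eq_iff[symmetric] fun_eq_iff poly_pcompose algebra_simps)
  have "boundary_eval e p K (dirac e (dirac e ?\<psi>)) y
      = boundary_eval e (p * [:-1, 0, 1:]) (Suc (Suc K)) ?\<psi> y"
    unfolding boundary_eval_dirac[OF e smooth_dirac[OF smooth_dirac_funpow[OF \<psi>]] Suc.prems]
      boundary_eval_dirac[OF e smooth_dirac_funpow[OF \<psi>] deg] q boundary_eval_smult
    by (simp add: vector_scalar_commute clifford_square[OF e] vec_eq_iff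
        del: mult_pCons_left mult_pCons_right)
  then show ?case
    by (simp add: Suc.IH[OF deg2] mult.assoc del: mult_pCons_left mult_pCons_right)
qed simp

text \<open>The even power is applied to \<open>dirac e \<psi>\<close>, then one single step
  follows; \<open>x^2 - 1\<close> is even, so its powers survive the reflection.\<close>

lemma boundary_eval_dirac_odd_power:
  fixes e :: "'m::finite option \<Rightarrow> complex ^ 's::finite ^ 's"
  assumes e: "spinor_module e" and \<psi>: "smooth_on_set upper_half_space \<psi>" and p: "degree p \<le> K"
  shows "boundary_eval e p K ((dirac e ^^ (2 * M + 1)) \<psi>) y
    = e None *v boundary_eval e (reflect p * [:-1, 0, 1:] ^ M * [:1, -1:]) (K + 2 * M + 1) \<psi> y"
proof -
  have "degree (p * [:-1, 0, 1:] ^ M) \<le> degree p + degree [:-1, 0, 1::complex:] * M"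
    using degree_mult_le[of p "[:-1, 0, 1:] ^ M"] degree_power_le[of "[:-1, 0, 1::complex:]" M]
    by linarith
  then have deg: "degree (p * [:-1, 0, 1:] ^ M) \<le> K + 2 * M" using p by simp
  have "reflect (p * [:-1, 0, 1:] ^ M) = reflect p * [:-1, 0, 1:] ^ M"
    by (simp add: poly_eq_poly_eq_iff[symmetric] fun_eq_iff poly_pcompose poly_power)
  then show ?thesis
    using boundary_eval_dirac_even_power[OF e smooth_dirac[OF \<psi>] p]
      boundary_eval_dirac[OF e \<psi> deg]
    by (simp add: funpow_Suc_right del: funpow.simps mult_pCons_left mult_pCons_right)
qed

section \<open>Residue families as evaluated polynomials, and their factorization\<close>

text \<open>Each component of the rational formula agrees, off the finitely many zeros of a
  Pochhammer symbol, with a polynomial in the spectral parameter; this polynomial is then the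
  continuation.\<close>

lemma residue_family_eq_boundary_eval:
  fixes e :: "'m::finite option \<Rightarrow> complex ^ 's ^ 's"
  shows "residue_family e K lam \<psi> y =
    boundary_eval e (residue_poly K (lam + of_nat CARD('m option) / 2 - of_nat K)) K \<psi> y"
proof -
  define s :: complex where "s = of_nat CARD('m option) / 2 - of_nat K"
  define v where "v a j = (D_boundary e ^^ j) (boundary_jet (K - j) \<psi>) y $ a" for a j
  define d where "d j = (K + 1) div 2 - (j + 1) div 2" for j
  define c :: "nat \<Rightarrow> complex" where
    "c j = 2 ^ K * fact (K div 2) / (2 ^ j * fact (j div 2) * fact (K - j))" for j
  define p where "p a = (\<Sum>j\<le>K. smult (c j * v a j) (pochhammer [:s + of_nat ((j + 1) div 2), 1:] (d j)))" for a
  have p: "poly (p a) \<mu> = (\<Sum>j\<le>K. residue_coeff K (\<mu> + s) j * v a j)" for a \<mu>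
    by (simp add: p_def poly_sum poly_pochhammer residue_coeff_def c_def d_def add_ac mult_ac)
  have eq: "poly (p a) \<mu> = residue_family_rational e K \<mu> \<psi> y $ a"
    if nz: "pochhammer (\<mu> + s) ((K + 1) div 2) \<noteq> 0" for a \<mu>
  proof -
    \<comment> \<open>The solution coefficients and the prefactor thus have Pochhammer symbols with
      the same base \<open>\<mu> + s\<close>, which is what makes them cancel.\<close>
    have shift: "1/2 + (\<mu> + (of_nat CARD('m option) - 1) / 2 - of_nat K) = \<mu> + s"
      by (simp add: s_def field_simps)
    have "residue_coeff K (\<mu> + s) j
        = c j * (pochhammer (\<mu> + s) ((K + 1) div 2) / pochhammer (\<mu> + s) ((j + 1) div 2))"
      if "j \<le> K" for j
    proof -
      have "(j + 1) div 2 \<le> (K + 1) div 2" using that by (simp add: div_le_mono)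
      from pochhammer_product[OF this, of "\<mu> + s"] nz show ?thesis
        by (simp add: residue_coeff_def c_def)
    qed
    then have "poly (p a) \<mu> = (\<Sum>j\<le>K. c j * (pochhammer (\<mu> + s) ((K + 1) div 2)
        / pochhammer (\<mu> + s) ((j + 1) div 2)) * v a j)"
      unfolding p by (intro sum.cong) auto
    also have "\<dots> = residue_family_rational e K \<mu> \<psi> y $ a"
      unfolding residue_family_rational_def Let_def delta_family_def solution_op_def
        solution_coeff_pochhammer shift residue_prefactor_pochhammer s_def[symmetric]
      by (simp add: sum_distrib_left c_def v_def boundary_jet_def mult_ac)
    finally show ?thesis .
  qed
  have "finite {\<mu>. poly (p a) \<mu> \<noteq> residue_family_rational e K \<mu> \<psi> y $ a}" for a
  proof (rule finite_subset)
    show "{\<mu>. poly (p a) \<mu> \<noteq> residue_family_rational e K \<mu> \<psi> y $ a}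
        \<subseteq> (\<lambda>k. - of_nat k - s) ` {..<(K + 1) div 2}"
    proof
      fix \<mu> assume "\<mu> \<in> {\<mu>. poly (p a) \<mu> \<noteq> residue_family_rational e K \<mu> \<psi> y $ a}"
      then have "pochhammer (\<mu> + s) ((K + 1) div 2) = 0" using eq by blast
      then obtain k where "k < (K + 1) div 2" "\<mu> + s = - of_nat k"
        by (auto simp: pochhammer_eq_0_iff)
      then show "\<mu> \<in> (\<lambda>k. - of_nat k - s) ` {..<(K + 1) div 2}"
        by (auto intro!: image_eqI[of _ _ k] simp: algebra_simps eq_neg_iff_add_eq_0)
    qed
  qed simp
  then have "residue_family e K lam \<psi> y $ a = poly (p a) lam" for a
    by (simp add: residue_family_def poly_continuation_eq)
  then show ?thesis
    by (simp add: vec_eq_iff p boundary_eval_def coeff_residue_poly v_def s_def diff_add_eq add_diff_eq)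
qed

lemma residue_family_factor:
  fixes e :: "'m::finite option \<Rightarrow> complex ^ 's::finite ^ 's"
  assumes n: "n = CARD('m option)" and e: "spinor_module e"
    and \<psi>: "smooth_on_set upper_half_space \<psi>" and K: "K = L + 2 * M + 1"
    and lam: "lam = (1 - of_nat n) / 2 + of_nat M" "lam' = - (1 + of_nat n) / 2 - of_nat M"
  shows "residue_family e K lam \<psi> y
    = (- 1) ^ Suc K *s (e None *v residue_family e L lam' ((dirac e ^^ (2 * M + 1)) \<psi>) y)"
proof -
  define a :: complex where "a = 1/2 + of_nat M - of_nat K"
  \<comment> \<open>The two shifted parameters coincide, so both sides involve residue polynomials
    with the same \<open>a\<close>.\<close>
  have a: "lam + of_nat CARD('m option) / 2 - of_nat K = a"
      "lam' + of_nat CARD('m option) / 2 - of_nat L = a"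
    unfolding n[symmetric] lam a_def K by (simp_all add: field_simps)
  show ?thesis
    unfolding residue_family_eq_boundary_eval a
      boundary_eval_dirac_odd_power[OF e \<psi> degree_residue_poly_le]
      residue_poly_factor[OF K a_def] boundary_eval_smult K[symmetric] clifford_square[OF e]
    by (simp add: vec_eq_iff)
qed

theorem theorem5p6:
  fixes e :: "'m::finite option \<Rightarrow> complex ^ 's::finite ^ 's"
    and n :: nat
  assumes "n = CARD('m option)" and "n \<ge> 2"
    and "spinor_module e"
  shows
    "(\<forall>N M. 1 \<le> N \<and> M \<le> N - 1 \<longrightarrow>
       (\<forall>\<psi>. smooth_on_set upper_half_space \<psi> \<longrightarrow>
          residue_family e (2 * N) ((1 - of_nat n) / 2 + of_nat M) \<psi> =
          (\<lambda>y. - (e None *v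
             residue_family e (2 * (N - M - 1) + 1) (- (1 + of_nat n) / 2 - of_nat M)
               ((dirac e ^^ (2 * M + 1)) \<psi>) y)))) \<and>
     (\<forall>N M. 1 \<le> N \<and> M \<le> N \<longrightarrow>
       (\<forall>\<psi>. smooth_on_set upper_half_space \<psi> \<longrightarrow>
          residue_family e (2 * N + 1) ((1 - of_nat n) / 2 + of_nat M) \<psi> =
          (\<lambda>y. e None *v
             residue_family e (2 * N - 2 * M) (- (of_nat n + 1) / 2 - of_nat M)
               ((dirac e ^^ (2 * M + 1)) \<psi>) y)))"
proof (intro conjI allI impI ext)
  fix N M :: nat and \<psi> :: "real ^ ('m option) \<Rightarrow> complex ^ 's" and y
  assume "1 \<le> N \<and> M \<le> N - 1" and \<psi>: "smooth_on_set upper_half_space \<psi>"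
  \<comment> \<open>Here \<open>L = 2 * (N - M - 1) + 1\<close>; the order is even, so the sign
    \<open>(- 1) ^ Suc K\<close> is \<open>- 1\<close>.\<close>
  then have "2 * N = 2 * (N - M - 1) + 1 + 2 * M + 1" by auto
  from residue_family_factor[OF assms(1,3) \<psi> this refl refl]
  show "residue_family e (2 * N) ((1 - of_nat n) / 2 + of_nat M) \<psi> y =
      - (e None *v residue_family e (2 * (N - M - 1) + 1) (- (1 + of_nat n) / 2 - of_nat M)
        ((dirac e ^^ (2 * M + 1)) \<psi>) y)"
    by (simp add: vec_eq_iff del: funpow.simps)
next
  fix N M :: nat and \<psi> :: "real ^ ('m option) \<Rightarrow> complex ^ 's" and y
  assume "1 \<le> N \<and> M \<le> N" and \<psi>: "smooth_on_set upper_half_space \<psi>"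
  \<comment> \<open>Here \<open>L = 2 * N - 2 * M\<close>, an untruncated difference because
    \<open>M \<le> N\<close>; the order is odd and the sign is \<open>1\<close>.\<close>
  then have "2 * N + 1 = 2 * N - 2 * M + 2 * M + 1" by auto
  from residue_family_factor[OF assms(1,3) \<psi> this refl refl]
  show "residue_family e (2 * N + 1) ((1 - of_nat n) / 2 + of_nat M) \<psi> y =
      e None *v residue_family e (2 * N - 2 * M) (- (of_nat n + 1) / 2 - of_nat M)
        ((dirac e ^^ (2 * M + 1)) \<psi>) y"
    by (simp add: vec_eq_iff add.commute del: funpow.simps)
qed

end
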